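(* Let $k$ be a positive integer, $0\le\gamma<1$, $\phi\in\mathcal{S}^*\left(\frac{k-1}{k}\right)$, and let $C_m$ ($m\ge2$) be the coefficients in $\Phi_k(z)=\frac{\phi_k(z)}{z^{k-1}}=z+\sum_{m=2}^\infty C_m z^m$. Let $\mathfrak{f}=\mathfrak{u}+\overline{\mathfrak{v}}\in\mathcal{SH}^{0}$ with $\mathfrak{u}(z)=z+\sum_{m=2}^\infty u_m z^m$ and $\mathfrak{v}(z)=\sum_{m=2}^\infty v_m z^m$. If $$\sum_{m=2}^{\infty}2m\left(|u_m|+|v_m|\right)+\sum_{m=2}^{\infty}\left(|1-2\gamma|+1\right)|C_m|\le 2(1-\gamma),$$ then $\mathfrak{f}\in\mathcal{KH}^{0}(k,\gamma)$.
   Context: $\mathbb{E}=\{z\in\mathbb{C}:|z|<1\}$. $\mathcal{SH}^0$ is the class of univalent, sense-preserving harmonic functions $\mathfrak{f}=\mathfrak{u}+\overline{\mathfrak{v}}$ on $\mathbb{E}$, where $\mathfrak{u}(z)=z+\sum_{m=2}^\infty u_m z^m$ and $\mathfrak{v}(z)=\sum_{m=2}^\infty v_m z^m$ are analytic in $\mathbb{E}$. For $0\le\beta<1$, $\mathcal{S}^*(\beta)$ is the class of analytic functions $\phi(z)=z+\sum_{m=2}^\infty c_m z^m$ on $\mathbb{E}$ that are starlike of order $\beta$, i.e. $\mathrm{Re}\{z\phi'(z)/\phi(z)\}>\beta$ in $\mathbb{E}$. Given a positive integer $k$ and a fixed $\phi\in\mathcal{S}^*\left(\frac{k-1}{k}\right)$,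 put $\mu=e^{2\pi i/k}$ and $\phi_k(z)=\prod_{v=0}^{k-1}\mu^{-v}\phi(\mu^v z)$. For $0\le\gamma<1$, $\mathcal{KH}^0(k,\gamma)$ is the class of all $\mathfrak{f}=\mathfrak{u}+\overline{\mathfrak{v}}\in\mathcal{SH}^0$ satisfying, for all $z\in\mathbb{E}$, $$\mathrm{Re}\left\{\frac{z^k\mathfrak{u}'(z)}{\phi_k(z)}-\gamma\right\}>\left|\frac{z^k\mathfrak{v}'(z)}{\phi_k(z)}\right|$$ (the quotient $z^k/\phi_k(z)$ has a removable singularity at $0$, with value $1$ there). *)

theory Defs
  imports "HOL-Complex_Analysis.Complex_Analysis"
begin

abbreviation unit_disc :: "complex set" where
  "unit_disc \<equiv> ball 0 1"

definition tail_series :: "(complex \<Rightarrow> complex) \<Rightarrow> (nat \<Rightarrow> complex) \<Rightarrow> bool" where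
  "tail_series g c \<longleftrightarrow> (\<forall>z\<in>unit_disc. ((\<lambda>m. c m * z ^ m) has_sum g z) {2..})"
  \<comment> \<open>The values \<open>c 0\<close> and \<open>c 1\<close> are irrelevant.\<close>

definition canonical_rep ::
  "(complex \<Rightarrow> complex) \<Rightarrow> (complex \<Rightarrow> complex) \<Rightarrow> (complex \<Rightarrow> complex)
    \<Rightarrow> (nat \<Rightarrow> complex) \<Rightarrow> (nat \<Rightarrow> complex) \<Rightarrow> bool" where
  "canonical_rep f u v a b \<longleftrightarrow>
     u holomorphic_on unit_disc \<and> v holomorphic_on unit_disc \<and>
     (\<forall>z\<in>unit_disc. f z = u z + cnj (v z)) \<and>
     tail_series (\<lambda>z. u z - z) a \<and> tail_series v b"

text \<open>
  The Jacobian determinant of \<open>f\<close> as a map of the real plane; for a harmonic map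
  \<open>u + cnj v\<close> it is \<open>|u'|^2 - |v'|^2\<close>. As usual for harmonic maps, sense-preserving means
  that it is positive (for univalent harmonic maps it never vanishes, by Lewy's theorem).
\<close>

definition jacobian :: "(complex \<Rightarrow> complex) \<Rightarrow> complex \<Rightarrow> real" where
  "jacobian f z =
     (let D = frechet_derivative f (at z)
      in Re (D 1) * Im (D \<i>) - Re (D \<i>) * Im (D 1))"

definition sense_preserving_on :: "(complex \<Rightarrow> complex) \<Rightarrow> complex set \<Rightarrow> bool" where
  "sense_preserving_on f A \<longleftrightarrow> (\<forall>z\<in>A. jacobian f z > 0)"

definition SH0 :: "(complex \<Rightarrow> complex) set" where
  "SH0 = {f. (\<exists>u v a b. canonical_rep f u v a b) \<and>
             inj_on f unit_disc \<and> sense_preserving_on f unit_disc}"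

text \<open>
  The origin is left out in the next definition because \<open>z * \<phi>' z / \<phi> z\<close> has a removable
  singularity there, with value \<open>1 > \<beta>\<close>, whereas HOL evaluates \<open>0 / 0\<close> to \<open>0\<close>.
\<close>

definition starlike_of_order :: "real \<Rightarrow> (complex \<Rightarrow> complex) set" where
  "starlike_of_order \<beta> =
     {\<phi>. \<phi> holomorphic_on unit_disc \<and> (\<exists>c. tail_series (\<lambda>z. \<phi> z - z) c) \<and>
         (\<forall>z\<in>unit_disc - {0}. \<phi> z \<noteq> 0 \<and> Re (z * deriv \<phi> z / \<phi> z) > \<beta>)}"

definition root_mu :: "nat \<Rightarrow> complex" where
  "root_mu k = exp (2 * of_real pi * \<i> / of_nat k)"

definition phi_sym :: "nat \<Rightarrow> (complex \<Rightarrow> complex) \<Rightarrow> complex \<Rightarrow> complex" where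
  "phi_sym k \<phi> z = (\<Prod>v<k. root_mu k powi (- int v) * \<phi> (root_mu k ^ v * z))"

text \<open>
  In \<open>Phi_sym\<close> the removable singularity at \<open>0\<close> needs no case distinction: the continuous
  extension has value \<open>0\<close> there, and so has the HOL quotient since \<open>phi_sym k \<phi> 0 = 0\<close>.
\<close>

definition Phi_sym :: "nat \<Rightarrow> (complex \<Rightarrow> complex) \<Rightarrow> complex \<Rightarrow> complex" where
  "Phi_sym k \<phi> z = phi_sym k \<phi> z / z ^ (k - 1)"

definition phi_quot :: "nat \<Rightarrow> (complex \<Rightarrow> complex) \<Rightarrow> complex \<Rightarrow> complex" where
  "phi_quot k \<phi> z = (if z = 0 then 1 else z ^ k / phi_sym k \<phi> z)"

text \<open>
  The parts \<open>u\<close> and \<open>v\<close> are determined by \<open>f\<close> on the disc, so the existential quantifier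
  in the next definition only names them.
\<close>

definition KH0 :: "nat \<Rightarrow> real \<Rightarrow> (complex \<Rightarrow> complex) \<Rightarrow> (complex \<Rightarrow> complex) set" where
  "KH0 k \<gamma> \<phi> =
     {f \<in> SH0. \<exists>u v a b. canonical_rep f u v a b \<and>
        (\<forall>z\<in>unit_disc. Re (phi_quot k \<phi> z * deriv u z - of_real \<gamma>)
                         > cmod (phi_quot k \<phi> z * deriv v z))}"

end

theory Submission
  imports Defs
begin

text \<open>
  Write \<open>g z = Phi_sym k \<phi> z / z\<close>, continued by \<open>g 0 = 1\<close>, so that the claim reads
  \<open>Re (u' / g - \<gamma>) > cmod (v' / g)\<close>. Rotating \<open>v' / g\<close> onto the negative real axis by a
  unimodular \<open>\<epsilon>\<close>, it is enough that \<open>p = u' + \<epsilon> v'\<close> satisfies \<open>Re (p / g) > \<gamma>\<close>. Now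
  \<open>\<gamma>\<close> is the midpoint of \<open>1\<close> and \<open>2\<gamma> - 1\<close>, so this half-plane consists of the points nearer
  to \<open>1\<close> than to \<open>2\<gamma> - 1\<close>; without denominators,
  \<open>cmod (p - g) < cmod (p + (1 - 2\<gamma>) g)\<close> (lemma \<open>Re_divide_gt_if_closer\<close>).

  Both sides are controlled by coefficients. All of \<open>u' - 1\<close>, \<open>v'\<close> and \<open>g - 1\<close> are power
  series without constant term, hence bounded by \<open>cmod z\<close> times the sums \<open>A\<close>, \<open>B\<close>, \<open>D\<close> of
  \<open>m |a m|\<close>, \<open>m |b m|\<close>, \<open>|C m|\<close> (lemmas \<open>norm_deriv_tail_series_le\<close> and
  \<open>norm_tail_series_le\<close>). The left side is at most \<open>|z| (A + B + D)\<close> and the right side at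
  least \<open>2 (1 - \<gamma>) - |z| (A + B + |1 - 2\<gamma>| D)\<close>. The hypothesis on the coefficients is that
  these bounds agree or better at \<open>|z| = 1\<close>, and \<open>|z| < 1\<close> makes the inequality strict
  (lemma \<open>Re_divide_minus_gt_norm_divide\<close>).
\<close>

text \<open>
  After division by \<open>g\<close>, expand the squared moduli of \<open>w - 1\<close> and \<open>w + (1 - 2\<gamma>)\<close> for \<open>w = p / g\<close>: the
  first minus the second is \<open>4 (1 - \<gamma>) (\<gamma> - Re w)\<close>. That \<open>g \<noteq> 0\<close> is part of the hypothesis: for
  \<open>g = 0\<close> the two moduli coincide.
\<close>

lemma Re_divide_gt_if_closer:
  fixes p g :: complex and \<gamma> :: real
  assumes "\<gamma> < 1" and closer: "cmod (p - g) < cmod (p + of_real (1 - 2 * \<gamma>) * g)"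
  shows "Re (p / g) > \<gamma>"
proof -
  have g: "g \<noteq> 0"
    using closer by auto
  define w where "w = p / g"
  have "p - g = (w - 1) * g" "p + of_real (1 - 2 * \<gamma>) * g = (w + of_real (1 - 2 * \<gamma>)) * g"
    using g by (simp_all add: w_def field_simps)
  with closer g have "cmod (w - 1) < cmod (w + of_real (1 - 2 * \<gamma>))"
    by (simp add: norm_mult)
  hence "(cmod (w - 1))\<^sup>2 < (cmod (w + of_real (1 - 2 * \<gamma>)))\<^sup>2"
    by (simp add: power_strict_mono)
  hence "0 < 4 * ((1 - \<gamma>) * (Re w - \<gamma>))"
    by (simp only: cmod_power2) (simp add: power2_eq_square algebra_simps)
  hence "0 < Re w - \<gamma>"
    using \<open>\<gamma> < 1\<close> by (simp add: zero_less_mult_iff)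
  thus ?thesis
    by (simp add: w_def)
qed

lemma Re_divide_minus_gt_norm_divide:
  fixes p q g :: complex and \<gamma> r A B D :: real
  assumes "\<gamma> < 1" "0 \<le> r" "r < 1"
    and p: "cmod (p - 1) \<le> r * A" and q: "cmod q \<le> r * B" and g: "cmod (g - 1) \<le> r * D"
    and le: "2 * (A + B) + (\<bar>1 - 2 * \<gamma>\<bar> + 1) * D \<le> 2 * (1 - \<gamma>)"
  shows "Re (p / g - of_real \<gamma>) > cmod (q / g)"
proof -
  \<comment> \<open>\<open>\<epsilon>\<close> turns \<open>q / g\<close> to the negative real axis, the worst case for the real part.\<close>
  obtain \<epsilon> :: complex where \<epsilon>: "cmod \<epsilon> = 1" "\<epsilon> * (q / g) = - of_real (cmod (q / g))"
  proof (cases "q / g = 0")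
    case True
    show ?thesis by (rule that[of 1]) (simp_all only: True, simp_all)
  next
    case False
    show ?thesis
    proof (rule that)
      show "cmod (- of_real (cmod (q / g)) / (q / g)) = 1"
        using False by (simp add: norm_divide norm_mult)
      show "- of_real (cmod (q / g)) / (q / g) * (q / g) = - of_real (cmod (q / g))"
        using False by simp
    qed
  qed
  define P where "P = p + \<epsilon> * q"
  have "cmod (P - 1) = cmod ((p - 1) + \<epsilon> * q)"
    by (simp add: P_def algebra_simps)
  also have "\<dots> \<le> cmod (p - 1) + cmod (\<epsilon> * q)"
    by (rule norm_triangle_ineq)
  finally have P: "cmod (P - 1) \<le> r * A + r * B"
    using p q \<epsilon> by (simp add: norm_mult)
  have "cmod (P - g) = cmod ((P - 1) - (g - 1))"
    by simp
  also have "\<dots> \<le> cmod (P - 1) + cmod (g - 1)"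
    by (rule norm_triangle_ineq4)
  finally have upper: "cmod (P - g) \<le> r * A + r * B + r * D"
    using P g by linarith
  define E where "E = (P - 1) + of_real (1 - 2 * \<gamma>) * (g - 1)"
  have "cmod (of_real (1 - 2 * \<gamma>) * (g - 1)) \<le> \<bar>1 - 2 * \<gamma>\<bar> * (r * D)"
    unfolding norm_mult norm_of_real using g by (intro mult_left_mono) auto
  hence E: "cmod E \<le> r * A + r * B + \<bar>1 - 2 * \<gamma>\<bar> * (r * D)"
    using P norm_triangle_ineq[of "P - 1" "of_real (1 - 2 * \<gamma>) * (g - 1)"]
    unfolding E_def by linarith
  have "P + of_real (1 - 2 * \<gamma>) * g = of_real (2 * (1 - \<gamma>)) + E"
    by (simp add: E_def algebra_simps)
  moreover have "cmod (of_real (2 * (1 - \<gamma>)) :: complex) = 2 * (1 - \<gamma>)"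
    unfolding norm_of_real using \<open>\<gamma> < 1\<close> by simp
  ultimately have lower: "2 * (1 - \<gamma>) - cmod E \<le> cmod (P + of_real (1 - 2 * \<gamma>) * g)"
    using norm_diff_ineq[of "of_real (2 * (1 - \<gamma>))" E] by simp
  have "r * (2 * (A + B) + (\<bar>1 - 2 * \<gamma>\<bar> + 1) * D) \<le> r * (2 * (1 - \<gamma>))"
    using le \<open>0 \<le> r\<close> by (rule mult_left_mono)
  also have "\<dots> < 2 * (1 - \<gamma>)"
    using \<open>r < 1\<close> \<open>\<gamma> < 1\<close> by simp
  finally have "r * A + r * B + r * D + (r * A + r * B + \<bar>1 - 2 * \<gamma>\<bar> * (r * D)) < 2 * (1 - \<gamma>)"
    by (simp add: algebra_simps)
  hence "cmod (P - g) < cmod (P + of_real (1 - 2 * \<gamma>) * g)"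
    using upper lower E by linarith
  hence "Re (P / g) > \<gamma>"
    using \<open>\<gamma> < 1\<close> by (rule Re_divide_gt_if_closer[rotated])
  moreover have "P / g = p / g - of_real (cmod (q / g))"
    using \<epsilon> by (simp add: P_def add_divide_distrib)
  ultimately show ?thesis
    by simp
qed

text \<open>
  Every term contains the factor \<open>z\<^sup>2\<close>. Both powers are kept because the bound is used for
  \<open>Phi_sym k \<phi> z - z\<close> after division by \<open>z\<close>, where one of them must survive.
\<close>

lemma norm_tail_series_le:
  assumes h: "tail_series h c" and c: "(\<lambda>m. cmod (c m)) summable_on {2..}"
    and z: "z \<in> unit_disc"
  shows "cmod (h z) \<le> (cmod z)\<^sup>2 * (\<Sum>\<^sub>\<infinity>m\<in>{2..}. cmod (c m))"
proof -
  have "((\<lambda>m. c m * z ^ m) has_sum h z) {2..}"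
    using h z by (simp add: tail_series_def)
  moreover have "((\<lambda>m. (cmod z)\<^sup>2 * cmod (c m)) has_sum
      (cmod z)\<^sup>2 * (\<Sum>\<^sub>\<infinity>m\<in>{2..}. cmod (c m))) {2..}"
    using c by (intro has_sum_cmult_right has_sum_infsum)
  moreover have "cmod (c m * z ^ m) \<le> (cmod z)\<^sup>2 * cmod (c m)" if "m \<in> {2..}" for m
  proof -
    have "cmod z ^ m \<le> (cmod z)\<^sup>2"
      using that z by (intro power_decreasing) auto
    hence "cmod z ^ m * cmod (c m) \<le> (cmod z)\<^sup>2 * cmod (c m)"
      by (rule mult_right_mono) simp
    thus ?thesis
      by (simp add: norm_mult norm_power mult.commute)
  qed
  ultimately show ?thesis
    by (rule norm_infsum_le)
qed

text \<open>
  The differentiated series has \<open>m c m z^(m - 1)\<close> as its term for \<open>m \<ge> 2\<close>, and each of these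
  carries at least one factor \<open>z\<close>. Termwise differentiation is available for series indexed
  from \<open>0\<close>, so the coefficients are first extended by \<open>0\<close>.
\<close>

lemma norm_deriv_tail_series_le:
  assumes h: "tail_series h c" and c: "(\<lambda>m. real m * cmod (c m)) summable_on {2..}"
    and z: "z \<in> unit_disc"
  shows "cmod (deriv h z) \<le> cmod z * (\<Sum>\<^sub>\<infinity>m\<in>{2..}. real m * cmod (c m))"
proof -
  define d where "d = (\<lambda>m. if m \<ge> 2 then c m else 0)"
  have sums: "(\<lambda>m. d m * w ^ m) sums h w" if "w \<in> unit_disc" for w
  proof -
    have "((\<lambda>m. c m * w ^ m) has_sum h w) {2..}"
      using h that by (simp add: tail_series_def)
    also have "?this \<longleftrightarrow> ((\<lambda>m. d m * w ^ m) has_sum h w) UNIV"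
      by (rule has_sum_cong_neutral) (auto simp: d_def)
    finally show ?thesis
      by (rule has_sum_imp_sums)
  qed
  have "((\<lambda>w. \<Sum>m. d m * w ^ m) has_field_derivative (\<Sum>m. diffs d m * z ^ m)) (at z)"
    using z by (intro termdiffs_strong'[where K = 1] sums_summable[OF sums]) auto
  moreover have "eventually (\<lambda>w. w \<in> unit_disc) (nhds z)"
    using z by (intro eventually_nhds_in_open) auto
  hence "eventually (\<lambda>w. (\<Sum>m. d m * w ^ m) = h w) (nhds z)"
    by eventually_elim (use sums in \<open>auto simp: sums_iff\<close>)
  ultimately have "(h has_field_derivative (\<Sum>m. diffs d m * z ^ m)) (at z)"
    by (subst (asm) DERIV_cong_ev) auto
  hence deriv: "deriv h z = (\<Sum>m. diffs d m * z ^ m)"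
    by (rule DERIV_imp_deriv)
  have "((\<lambda>m. real m * cmod (c m)) has_sum (\<Sum>\<^sub>\<infinity>m\<in>{2..}. real m * cmod (c m))) {2..}"
    using c by (rule has_sum_infsum)
  also have "?this \<longleftrightarrow>
      ((\<lambda>m. real m * cmod (d m)) has_sum (\<Sum>\<^sub>\<infinity>m\<in>{2..}. real m * cmod (c m))) UNIV"
    by (rule has_sum_cong_neutral) (auto simp: d_def)
  finally have "(\<lambda>m. real m * cmod (d m)) sums (\<Sum>\<^sub>\<infinity>m\<in>{2..}. real m * cmod (c m))"
    by (rule has_sum_imp_sums)
  hence "(\<lambda>m. real (Suc m) * cmod (d (Suc m))) sums (\<Sum>\<^sub>\<infinity>m\<in>{2..}. real m * cmod (c m))"
    by (subst sums_Suc_iff) simp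
  hence maj: "(\<lambda>m. cmod z * (real (Suc m) * cmod (d (Suc m)))) sums
      (cmod z * (\<Sum>\<^sub>\<infinity>m\<in>{2..}. real m * cmod (c m)))"
    by (rule sums_mult)
  have term_le: "cmod (diffs d m * z ^ m) \<le> cmod z * (real (Suc m) * cmod (d (Suc m)))" for m
  proof (cases m)
    case 0
    thus ?thesis by (simp add: diffs_def d_def)
  next
    case (Suc n)
    hence "cmod z ^ m \<le> cmod z ^ 1"
      using z by (intro power_decreasing) auto
    hence "cmod z ^ m * (real (Suc m) * cmod (d (Suc m)))
        \<le> cmod z * (real (Suc m) * cmod (d (Suc m)))"
      by (intro mult_right_mono) auto
    moreover have "cmod (diffs d m * z ^ m) = cmod z ^ m * (real (Suc m) * cmod (d (Suc m)))"
      unfolding diffs_def norm_mult norm_power norm_of_nat by (simp only: mult_ac)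
    ultimately show ?thesis
      by simp
  qed
  have "cmod (\<Sum>m. diffs d m * z ^ m) \<le> (\<Sum>m. cmod z * (real (Suc m) * cmod (d (Suc m))))"
    by (rule norm_suminf_le) (use maj term_le in \<open>auto simp: sums_iff\<close>)
  thus ?thesis
    using maj by (simp add: deriv sums_iff)
qed

theorem theorem3p7:
  fixes k :: nat and \<gamma> :: real
    and \<phi> f u v :: "complex \<Rightarrow> complex"
    and a b C :: "nat \<Rightarrow> complex"
  assumes "k \<ge> 1" and "0 \<le> \<gamma>" and "\<gamma> < 1"
    and "\<phi> \<in> starlike_of_order ((real k - 1) / real k)"
    and "tail_series (\<lambda>z. Phi_sym k \<phi> z - z) C"
    and "f \<in> SH0" and "canonical_rep f u v a b"
    and "(\<lambda>m. 2 * real m * (cmod (a m) + cmod (b m))) summable_on {2..}"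
    and "(\<lambda>m. (\<bar>1 - 2 * \<gamma>\<bar> + 1) * cmod (C m)) summable_on {2..}"
    and "(\<Sum>\<^sub>\<infinity>m\<in>{2..}. 2 * real m * (cmod (a m) + cmod (b m)))
         + (\<Sum>\<^sub>\<infinity>m\<in>{2..}. (\<bar>1 - 2 * \<gamma>\<bar> + 1) * cmod (C m)) \<le> 2 * (1 - \<gamma>)"
  shows "f \<in> KH0 k \<gamma> \<phi>"
proof -
  have u: "u holomorphic_on unit_disc" and a: "tail_series (\<lambda>z. u z - z) a"
    and b: "tail_series v b"
    using \<open>canonical_rep f u v a b\<close> by (auto simp: canonical_rep_def)
  define A where "A = (\<Sum>\<^sub>\<infinity>m\<in>{2..}. real m * cmod (a m))"
  define B where "B = (\<Sum>\<^sub>\<infinity>m\<in>{2..}. real m * cmod (b m))"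
  define D where "D = (\<Sum>\<^sub>\<infinity>m\<in>{2..}. cmod (C m))"
  have sum_a: "(\<lambda>m. real m * cmod (a m)) summable_on {2..}"
    by (rule summable_on_comparison_test[OF assms(8)])
      (auto simp: algebra_simps intro!: add_increasing2)
  have sum_b: "(\<lambda>m. real m * cmod (b m)) summable_on {2..}"
    by (rule summable_on_comparison_test[OF assms(8)])
      (auto simp: algebra_simps intro!: add_increasing)
  have sum_C: "(\<lambda>m. cmod (C m)) summable_on {2..}"
    by (rule summable_on_comparison_test[OF assms(9)]) (auto simp: algebra_simps)
  have AB: "(\<Sum>\<^sub>\<infinity>m\<in>{2..}. 2 * real m * (cmod (a m) + cmod (b m))) = 2 * (A + B)"
  proof -
    have "((\<lambda>m. 2 * (real m * cmod (a m) + real m * cmod (b m))) has_sum 2 * (A + B)) {2..}"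
      unfolding A_def B_def
      by (intro has_sum_cmult_right has_sum_add has_sum_infsum sum_a sum_b)
    thus ?thesis
      by (intro infsumI) (simp add: algebra_simps)
  qed
  have "(\<Sum>\<^sub>\<infinity>m\<in>{2..}. (\<bar>1 - 2 * \<gamma>\<bar> + 1) * cmod (C m)) = (\<bar>1 - 2 * \<gamma>\<bar> + 1) * D"
    unfolding D_def by (rule infsum_cmult_right) (simp add: sum_C)
  with AB assms(10) have le: "2 * (A + B) + (\<bar>1 - 2 * \<gamma>\<bar> + 1) * D \<le> 2 * (1 - \<gamma>)"
    by simp
  have "Re (phi_quot k \<phi> z * deriv u z - of_real \<gamma>) > cmod (phi_quot k \<phi> z * deriv v z)"
    if z: "z \<in> unit_disc" for z
  proof -
    define g where "g = (if z = 0 then 1 else Phi_sym k \<phi> z / z)"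
    have "deriv (\<lambda>z. u z - z) z = deriv u z - 1"
      using holomorphic_on_imp_differentiable_at[OF u _ z] by simp
    hence du: "cmod (deriv u z - 1) \<le> cmod z * A"
      using norm_deriv_tail_series_le[OF a sum_a z] by (simp add: A_def)
    have dv: "cmod (deriv v z) \<le> cmod z * B"
      using norm_deriv_tail_series_le[OF b sum_b z] by (simp add: B_def)
    have g: "cmod (g - 1) \<le> cmod z * D"
    proof (cases "z = 0")
      case False
      hence "cmod (g - 1) * cmod z = cmod (Phi_sym k \<phi> z - z)"
        by (simp add: g_def norm_mult[symmetric] algebra_simps)
      also have "\<dots> \<le> cmod z * D * cmod z"
        using norm_tail_series_le[OF assms(5) sum_C z]
        by (simp add: D_def power2_eq_square mult_ac)
      finally show ?thesis
        using False by (simp add: mult.commute)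
    qed (simp add: g_def)
    have quot: "phi_quot k \<phi> z * w = w / g" for w
    proof -
      have "z ^ k = z ^ (k - 1) * z"
        using \<open>k \<ge> 1\<close> by (metis power_minus_mult zero_less_one less_le_trans)
      thus ?thesis
        by (simp add: phi_quot_def g_def Phi_sym_def)
    qed
    have "Re (deriv u z / g - of_real \<gamma>) > cmod (deriv v z / g)"
      using z by (intro Re_divide_minus_gt_norm_divide[OF \<open>\<gamma> < 1\<close> _ _ du dv g le]) auto
    thus ?thesis
      by (simp only: quot)
  qed
  thus ?thesis
    using \<open>f \<in> SH0\<close> \<open>canonical_rep f u v a b\<close> unfolding KH0_def by blast
qed

end
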